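(* Let $F$ be a field and $F * A_1$, $F * A_2$ twisted group algebras of finitely generated free abelian groups over $F$. If $\dim(F * A_i)=\mathrm{rk}(A_i)$ for some $i\in\{1,2\}$, then $\dim(F * A_1\otimes_F F * A_2)=\dim(F * A_1)+\dim(F * A_2)$.
   Context: A twisted group algebra $F * A$ is an $F$-algebra with $F$-basis $\{\bar a: a\in A\}$ and $\bar a_1\bar a_2=\tau(a_1,a_2)\overline{a_1a_2}$, $\tau$ a 2-cocycle with values in $F\setminus\{0\}$. $\dim$ denotes the Krull dimension, which for these algebras coincides with the global dimension; $\mathrm{rk}$ is the rank. *)

theory Defs
  imports Main "HOL-Library.Extended_Nat"
begin

definition cocycle :: "'g set \<Rightarrow> ('g \<Rightarrow> 'g \<Rightarrow> 'g) \<Rightarrow> ('g \<Rightarrow> 'g \<Rightarrow> 'a::field) \<Rightarrow> bool" where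
  "cocycle G add \<tau> \<longleftrightarrow>
     (\<forall>a\<in>G. \<forall>b\<in>G. \<tau> a b \<noteq> 0) \<and>
     (\<forall>a\<in>G. \<forall>b\<in>G. \<forall>c\<in>G. \<tau> a b * \<tau> (add a b) c = \<tau> b c * \<tau> a (add b c))"

text \<open>Elements of F * G: finitely supported F-valued functions on G
  (f corresponds to the sum of f a times a-bar).\<close>

definition tga_carrier :: "'g set \<Rightarrow> ('g \<Rightarrow> 'a::field) set" where
  "tga_carrier G = {f. finite {x. f x \<noteq> 0} \<and> (\<forall>x. f x \<noteq> 0 \<longrightarrow> x \<in> G)}"

definition tga_add :: "('g \<Rightarrow> 'a::field) \<Rightarrow> ('g \<Rightarrow> 'a) \<Rightarrow> ('g \<Rightarrow> 'a)" where
  "tga_add f g = (\<lambda>x. f x + g x)"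

text \<open>Multiplication: a-bar * b-bar = tau a b * (ab)-bar, extended bilinearly.\<close>

definition tga_mult :: "('g \<Rightarrow> 'g \<Rightarrow> 'g) \<Rightarrow> ('g \<Rightarrow> 'g \<Rightarrow> 'a::field)
      \<Rightarrow> ('g \<Rightarrow> 'a) \<Rightarrow> ('g \<Rightarrow> 'a) \<Rightarrow> ('g \<Rightarrow> 'a)" where
  "tga_mult add \<tau> f g = (\<lambda>c. \<Sum>a\<in>{x. f x \<noteq> 0}. \<Sum>b\<in>{y. g y \<noteq> 0}.
                          (if add a b = c then f a * g b * \<tau> a b else 0))"

definition right_ideals :: "'g set \<Rightarrow> ('g \<Rightarrow> 'g \<Rightarrow> 'g) \<Rightarrow> ('g \<Rightarrow> 'g \<Rightarrow> 'a::field)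
      \<Rightarrow> ('g \<Rightarrow> 'a) set set" where
  "right_ideals G add \<tau> = {I. I \<subseteq> tga_carrier G \<and> (\<lambda>_. 0) \<in> I \<and>
       (\<forall>f\<in>I. \<forall>g\<in>I. tga_add f g \<in> I) \<and>
       (\<forall>f\<in>I. \<forall>r\<in>tga_carrier G. tga_mult add \<tau> f r \<in> I)}"

text \<open>dev_le k P means: the deviation of the poset (P, subset) is at most k - 1,
  where k = 0 stands for deviation minus infinity (trivial poset).
  dev P \<le> alpha iff for every descending chain all but finitely many factors
  have deviation < alpha.\<close>

fun dev_le :: "nat \<Rightarrow> 'b set set \<Rightarrow> bool" where
  "dev_le 0 P \<longleftrightarrow> (\<forall>x\<in>P. \<forall>y\<in>P. x \<subseteq> y \<longrightarrow> x = y)"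
| "dev_le (Suc k) P \<longleftrightarrow>
     (\<forall>c::nat \<Rightarrow> 'b set. (\<forall>i. c i \<in> P \<and> c (Suc i) \<subseteq> c i) \<longrightarrow>
        (\<forall>\<^sub>F i in sequentially. dev_le k {x\<in>P. c (Suc i) \<subseteq> x \<and> x \<subseteq> c i}))"

text \<open>Krull dimension of a (nonzero) ring = deviation of its lattice of right
  ideals; infinity if it is not a finite number.\<close>

definition krull_dim_poset :: "'b set set \<Rightarrow> enat" where
  "krull_dim_poset P = (if \<exists>k. dev_le (Suc k) P then enat (LEAST k. dev_le (Suc k) P) else \<infinity>)"

definition tga_dim :: "'g set \<Rightarrow> ('g \<Rightarrow> 'g \<Rightarrow> 'g) \<Rightarrow> ('g \<Rightarrow> 'g \<Rightarrow> 'a::field) \<Rightarrow> enat" where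
  "tga_dim G add \<tau> = krull_dim_poset (right_ideals G add \<tau>)"

definition Zn :: "nat \<Rightarrow> (nat \<Rightarrow> int) set" where
  "Zn n = {v. \<forall>i\<ge>n. v i = 0}"

definition zadd :: "(nat \<Rightarrow> int) \<Rightarrow> (nat \<Rightarrow> int) \<Rightarrow> (nat \<Rightarrow> int)" where
  "zadd a b = (\<lambda>i. a i + b i)"

text \<open>It has F-basis a1-bar \<otimes> a2-bar, indexed by pairs (a1,a2), with
  (a1-bar \<otimes> a2-bar)(b1-bar \<otimes> b2-bar) = tau1 a1 b1 * tau2 a2 b2 * ((a1 b1)-bar \<otimes> (a2 b2)-bar).\<close>

definition pair_add :: "('g \<Rightarrow> 'g \<Rightarrow> 'g) \<Rightarrow> ('h \<Rightarrow> 'h \<Rightarrow> 'h) \<Rightarrow> ('g \<times> 'h) \<Rightarrow> ('g \<times> 'h) \<Rightarrow> ('g \<times> 'h)" where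
  "pair_add add1 add2 x y = (add1 (fst x) (fst y), add2 (snd x) (snd y))"

definition tensor_cocycle :: "('g \<Rightarrow> 'g \<Rightarrow> 'a::field) \<Rightarrow> ('h \<Rightarrow> 'h \<Rightarrow> 'a) \<Rightarrow> ('g \<times> 'h) \<Rightarrow> ('g \<times> 'h) \<Rightarrow> 'a" where
  "tensor_cocycle \<tau>1 \<tau>2 x y = \<tau>1 (fst x) (fst y) * \<tau>2 (snd x) (snd y)"

definition tensor_tga_dim :: "'g set \<Rightarrow> ('g \<Rightarrow> 'g \<Rightarrow> 'g) \<Rightarrow> ('g \<Rightarrow> 'g \<Rightarrow> 'a::field)
     \<Rightarrow> 'h set \<Rightarrow> ('h \<Rightarrow> 'h \<Rightarrow> 'h) \<Rightarrow> ('h \<Rightarrow> 'h \<Rightarrow> 'a) \<Rightarrow> enat" where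
  "tensor_tga_dim G1 add1 \<tau>1 G2 add2 \<tau>2 =
     tga_dim (G1 \<times> G2) (pair_add add1 add2) (tensor_cocycle \<tau>1 \<tau>2)"

end

theory Submission
  imports Defs "HOL-Library.Function_Algebras" "HOL-Library.Product_Plus"
begin

text \<open>
  Write \<open>R\<^sub>i\<close> for the algebra \<open>F * A\<^sub>i\<close>. Extending a group by an infinite cyclic group raises the
  dimension of its twisted group algebra by at most one, since a right ideal is determined, among the
  right ideals containing it, by the increasing sequence of its right ideals of leading coefficients;
  so \<open>dim (R\<^sub>1 \<otimes> R\<^sub>2)\<close> is at most \<open>dim R\<^sub>1 + rk A\<^sub>2\<close> and at most \<open>rk A\<^sub>1 + dim R\<^sub>2\<close>. On the other hand
  \<open>dim (R\<^sub>1 \<otimes> R\<^sub>2) \<ge> dim R\<^sub>1 + dim R\<^sub>2\<close> always: a chain of right ideals \<open>I\<^sub>i\<close> of \<open>R\<^sub>1\<close> gives a chain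
  \<open>I\<^sub>i \<otimes> R\<^sub>2\<close>, and for \<open>I' \<subset> I\<close> the interval between \<open>I' \<otimes> R\<^sub>2\<close> and \<open>I \<otimes> R\<^sub>2\<close> contains a copy of the
  lattice of right ideals of \<open>R\<^sub>2\<close>. If \<open>dim R\<^sub>i = rk A\<^sub>i\<close> for some \<open>i\<close>, the two bounds agree.
\<close>

section \<open>Deviation of ordered sets\<close>

text \<open>The recursion of \<open>dev_le\<close> over an arbitrary order, so that it also applies
  to sequences of ideals ordered pointwise.\<close>

fun deviation_le :: "nat \<Rightarrow> 'c::order set \<Rightarrow> bool" where
  "deviation_le 0 P \<longleftrightarrow> (\<forall>x\<in>P. \<forall>y\<in>P. x \<le> y \<longrightarrow> x = y)"
| "deviation_le (Suc k) P \<longleftrightarrow>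
     (\<forall>c::nat \<Rightarrow> 'c. (\<forall>i. c i \<in> P \<and> c (Suc i) \<le> c i) \<longrightarrow>
        (\<forall>\<^sub>F i in sequentially. deviation_le k {x\<in>P. c (Suc i) \<le> x \<and> x \<le> c i}))"

lemma dev_le_eq_deviation_le: "dev_le k P = deviation_le k P"
  by (induction k arbitrary: P) simp_all

text \<open>The pair of \<open>f\<close> and \<open>g\<close> acts as a strictly monotone map into a
  product: almost all factors of a chain are small under \<open>f\<close> and under \<open>g\<close>
  at once. Injectivity is asked of comparable pairs only, since passing to leading coefficients
  provides no more.\<close>

lemma deviation_le_joint_map:
  assumes "deviation_le k Q1" "deviation_le k Q2"
    and "\<And>x. x \<in> P \<Longrightarrow> f x \<in> Q1" "\<And>x. x \<in> P \<Longrightarrow> g x \<in> Q2"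
    and "\<And>x y. x \<in> P \<Longrightarrow> y \<in> P \<Longrightarrow> x \<le> y \<Longrightarrow> f x \<le> f y"
    and "\<And>x y. x \<in> P \<Longrightarrow> y \<in> P \<Longrightarrow> x \<le> y \<Longrightarrow> g x \<le> g y"
    and "\<And>x y. x \<in> P \<Longrightarrow> y \<in> P \<Longrightarrow> x \<le> y \<Longrightarrow> f x = f y \<Longrightarrow> g x = g y \<Longrightarrow> x = y"
  shows "deviation_le k (P :: 'p::order set)"
  using assms
proof (induction k arbitrary: P Q1 Q2)
  case 0
  then show ?case by (metis deviation_le.simps(1))
next
  case (Suc k)
  show ?case unfolding deviation_le.simps
  proof (intro allI impI)
    fix c :: "nat \<Rightarrow> 'p" assume c: "\<forall>i. c i \<in> P \<and> c (Suc i) \<le> c i"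
    have 1: "\<forall>\<^sub>F i in sequentially. deviation_le k {x\<in>Q1. f (c (Suc i)) \<le> x \<and> x \<le> f (c i)}"
      by (rule Suc.prems(1)[unfolded deviation_le.simps, rule_format])
        (use c Suc.prems(3,5) in blast)
    have 2: "\<forall>\<^sub>F i in sequentially. deviation_le k {x\<in>Q2. g (c (Suc i)) \<le> x \<and> x \<le> g (c i)}"
      by (rule Suc.prems(2)[unfolded deviation_le.simps, rule_format])
        (use c Suc.prems(4,6) in blast)
    show "\<forall>\<^sub>F i in sequentially. deviation_le k {x \<in> P. c (Suc i) \<le> x \<and> x \<le> c i}"
      using 1 2
    proof eventually_elim
      case (elim i)
      show ?case
        by (rule Suc.IH[OF elim]) (use c Suc.prems(3-7) in auto)
    qed
  qed
qed

lemma deviation_le_map: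
  assumes "deviation_le k Q" and "\<And>x. x \<in> P \<Longrightarrow> f x \<in> Q"
    and "\<And>x y. x \<in> P \<Longrightarrow> y \<in> P \<Longrightarrow> x \<le> y \<Longrightarrow> f x \<le> f y"
    and "\<And>x y. x \<in> P \<Longrightarrow> y \<in> P \<Longrightarrow> x \<le> y \<Longrightarrow> f x = f y \<Longrightarrow> x = y"
  shows "deviation_le k P"
  by (rule deviation_le_joint_map[of k Q Q P f f]) (use assms in auto)

lemma deviation_le_subset: "deviation_le k Q \<Longrightarrow> P \<subseteq> Q \<Longrightarrow> deviation_le k P"
  by (rule deviation_le_map[of k Q P "\<lambda>x. x"]) auto

lemma deviation_le_1_if_chains_stabilise:
  assumes "\<And>c. (\<And>i. c i \<in> P \<and> c (Suc i) \<le> c i) \<Longrightarrow> \<exists>N. \<forall>i\<ge>N. c i = c N"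
  shows "deviation_le (Suc 0) P"
  unfolding deviation_le.simps
proof (intro allI impI)
  fix c :: "nat \<Rightarrow> 'a" assume "\<forall>i. c i \<in> P \<and> c (Suc i) \<le> c i"
  then obtain N where N: "\<forall>i\<ge>N. c i = c N" using assms by blast
  show "\<forall>\<^sub>F i in sequentially. \<forall>x\<in>{x \<in> P. c (Suc i) \<le> x \<and> x \<le> c i}.
            \<forall>y\<in>{x \<in> P. c (Suc i) \<le> x \<and> x \<le> c i}. x \<le> y \<longrightarrow> x = y"
    using eventually_ge_at_top[of N]
  proof eventually_elim
    case (elim i)
    then have "c (Suc i) = c i" using N by (metis le_Suc_eq)
    then show ?case by auto
  qed
qed

lemma deviation_le_Suc: "deviation_le k P \<Longrightarrow> deviation_le (Suc k) P"
proof (induction k arbitrary: P)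
  case 0
  show ?case
  proof (rule deviation_le_1_if_chains_stabilise)
    fix c assume c: "\<And>i. c i \<in> P \<and> c (Suc i) \<le> c i"
    then have "c (Suc i) = c i" for i using 0 by auto
    then have "c i = c 0" for i by (induction i) auto
    then show "\<exists>N. \<forall>i\<ge>N. c i = c N" by auto
  qed
next
  case (Suc k)
  show ?case
    unfolding deviation_le.simps(2)[of "Suc k"]
  proof (intro allI impI)
    fix c :: "nat \<Rightarrow> 'a" assume "\<forall>i. c i \<in> P \<and> c (Suc i) \<le> c i"
    then have "\<forall>\<^sub>F i in sequentially. deviation_le k {x\<in>P. c (Suc i) \<le> x \<and> x \<le> c i}"
      using Suc.prems by simp
    then show "\<forall>\<^sub>F i in sequentially. deviation_le (Suc k) {x\<in>P. c (Suc i) \<le> x \<and> x \<le> c i}"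
      by eventually_elim (rule Suc.IH)
  qed
qed

lemma deviation_le_mono: "k \<le> l \<Longrightarrow> deviation_le k P \<Longrightarrow> deviation_le l P"
  by (induction l rule: dec_induct) (blast intro: deviation_le_Suc)+

lemma deviation_le_1_finite:
  assumes "finite (P :: 'c::order set)"
  shows "deviation_le (Suc 0) P"
proof (rule deviation_le_1_if_chains_stabilise)
  fix c :: "nat \<Rightarrow> 'c" assume c: "\<And>i. c i \<in> P \<and> c (Suc i) \<le> c i"
  have "finite (range c)" using finite_subset[OF _ assms] c by blast
  then obtain N where N: "\<And>i. c i \<le> c N \<Longrightarrow> c i = c N"
    using finite_has_minimal[of "range c"] by (metis UNIV_not_empty image_is_empty rangeE rangeI)
  have "c i \<le> c N" if "N \<le> i" for i using that c by (simp add: lift_Suc_antimono_le)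
  then show "\<exists>N. \<forall>i\<ge>N. c i = c N" using N by blast
qed

text \<open>A bound on the deviation does not imply this condition (in the natural numbers every
  descending chain is stationary), so it is carried along separately; it gives every increasing
  sequence an eventual value.\<close>

definition acc :: "'c::order set \<Rightarrow> bool" where
  "acc P \<longleftrightarrow> (\<forall>c::nat \<Rightarrow> 'c. (\<forall>i. c i \<in> P \<and> c i \<le> c (Suc i)) \<longrightarrow> (\<exists>N. \<forall>i\<ge>N. c i = c N))"

lemma accD:
  "acc P \<Longrightarrow> (\<And>i. c i \<in> P) \<Longrightarrow> mono c \<Longrightarrow> \<exists>N::nat. \<forall>i\<ge>N. c i = c N"
  by (simp add: acc_def monoD)

lemma acc_subset: "acc Q \<Longrightarrow> P \<subseteq> Q \<Longrightarrow> acc P"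
  unfolding acc_def by blast

lemma acc_map:
  assumes "acc Q" and f: "\<And>x. x \<in> P \<Longrightarrow> f x \<in> Q"
    and fm: "\<And>x y. x \<in> P \<Longrightarrow> y \<in> P \<Longrightarrow> x \<le> y \<Longrightarrow> f x \<le> f y"
    and inj: "\<And>x y. x \<in> P \<Longrightarrow> y \<in> P \<Longrightarrow> x \<le> y \<Longrightarrow> f x = f y \<Longrightarrow> x = y"
  shows "acc (P :: 'p::order set)"
  unfolding acc_def
proof (intro allI impI)
  fix c :: "nat \<Rightarrow> 'p" assume c: "\<forall>i. c i \<in> P \<and> c i \<le> c (Suc i)"
  then have "\<exists>N. \<forall>i\<ge>N. f (c i) = f (c N)"
    using assms(1) f fm unfolding acc_def by (elim allE[of _ "\<lambda>i. f (c i)"]) auto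
  then obtain N where N: "\<forall>i\<ge>N. f (c i) = f (c N)" by blast
  have "c N \<le> c i" if "N \<le> i" for i using that c by (simp add: lift_Suc_mono_le)
  then show "\<exists>N. \<forall>i\<ge>N. c i = c N" using N inj c by metis
qed

lemma acc_finite:
  assumes "finite (P :: 'c::order set)"
  shows "acc P"
  unfolding acc_def
proof (intro allI impI)
  fix c :: "nat \<Rightarrow> 'c" assume c: "\<forall>i. c i \<in> P \<and> c i \<le> c (Suc i)"
  have "finite (range c)" using finite_subset[OF _ assms] c by blast
  then obtain N where N: "\<And>i. c N \<le> c i \<Longrightarrow> c i = c N"
    using finite_has_maximal[of "range c"] by (metis UNIV_not_empty image_is_empty rangeE rangeI)
  have "c N \<le> c i" if "N \<le> i" for i using that c by (simp add: lift_Suc_mono_le)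
  then show "\<exists>N. \<forall>i\<ge>N. c i = c N" using N by blast
qed

section \<open>Increasing sequences under the pointwise order\<close>

definition mono_seqs :: "'c::order set \<Rightarrow> (nat \<Rightarrow> 'c) set" where
  "mono_seqs P = {s. mono s \<and> (\<forall>n. s n \<in> P)}"

text \<open>As in Hilbert's basis theorem: the diagonal \<open>s i i\<close> becomes constant at
  some \<open>N\<close>, which by monotonicity freezes all entries with both indices at least
  \<open>N\<close>; the finitely many remaining columns stabilise one by one.\<close>

lemma acc_mono_seqs:
  assumes "acc (P :: 'c::order set)"
  shows "acc (mono_seqs P)"
  unfolding acc_def
proof (intro allI impI)
  fix s :: "nat \<Rightarrow> nat \<Rightarrow> 'c"
  assume s: "\<forall>i. s i \<in> mono_seqs P \<and> s i \<le> s (Suc i)"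
  have le1: "s i n \<le> s j n" if "i \<le> j" for i j n
    using lift_Suc_mono_le[of s i j] s that by (simp add: le_fun_def)
  have le: "s i n \<le> s j m" if "i \<le> j" "n \<le> m" for i j n m
  proof -
    have "mono (s j)" using s by (simp add: mono_seqs_def)
    then show ?thesis using le1[OF that(1), of n] that(2) by (blast dest: monoD intro: order_trans)
  qed
  have P: "s i n \<in> P" for i n using s by (simp add: mono_seqs_def)
  obtain N where N: "\<And>i. i \<ge> N \<Longrightarrow> s i i = s N N"
    using accD[OF assms, of "\<lambda>i. s i i"] P le by (auto simp: mono_def)
  have tail: "s i n = s N N" if "i \<ge> N" "n \<ge> N" for i n
    using N[of "max i n"] le[of i "max i n" n "max i n"] le[of N i N n] that by auto
  have "\<exists>M. \<forall>i\<ge>M. s i n = s M n" for n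
    using accD[OF assms, of "\<lambda>i. s i n"] P le1 by (auto simp: mono_def)
  then obtain m where m: "\<And>n i. i \<ge> m n \<Longrightarrow> s i n = s (m n) n" by metis
  \<comment> \<open>The sum serves as a common upper bound of the indices \<open>m n\<close> with
    \<open>n < N\<close>.\<close>
  define M where "M = N + (\<Sum>n<N. m n)"
  have "s i n = s M n" if "i \<ge> M" for i n
  proof (cases "n < N")
    case True
    then have "m n \<le> M" unfolding M_def
      by (meson finite_lessThan lessThan_iff member_le_sum trans_le_add2 zero_le)
    then show ?thesis using m[of n i] m[of n M] that by simp
  next
    case False
    then show ?thesis using tail[of i n] tail[of M n] that by (simp add: M_def)
  qed
  then show "\<exists>N. \<forall>i\<ge>N. s i = s N" by blast
qed

text \<open>Each induction step splits off entry \<open>m\<close> as the second component of a joint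
  map. Padding with \<open>undefined\<close> lets tuples of all lengths share one type.\<close>

lemma deviation_le_finite_power:
  assumes "deviation_le k P"
  shows "deviation_le k {s. (\<forall>n<m. s n \<in> P) \<and> (\<forall>n\<ge>m::nat. s n = undefined)}"
proof (induction m)
  case 0
  have eq: "{s. (\<forall>n<0. s n \<in> P) \<and> (\<forall>n\<ge>0::nat. s n = undefined)} = {\<lambda>_. undefined}"
    by auto
  have "deviation_le 0 {\<lambda>_::nat. undefined :: 'a}" by simp
  then show ?case unfolding eq using deviation_le_mono by blast
next
  case (Suc m)
  show ?case
  proof (rule deviation_le_joint_map[OF Suc.IH assms, of _ "\<lambda>s. s(m := undefined)" "\<lambda>s. s m"])
    fix x y :: "nat \<Rightarrow> 'a"
    assume eq: "x(m := undefined) = y(m := undefined)" "x m = y m"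
    show "x = y"
    proof
      fix n show "x n = y n" using eq(2) fun_cong[OF eq(1), of n] by (cases "n = m") auto
    qed
  qed (auto simp: le_fun_def)
qed

text \<open>By the ascending chain condition each sequence has an eventual value. Between two consecutive
  terms of a descending chain of sequences, only finitely many entries range over all of \<open>P\<close>; the
  others range over the interval between two consecutive eventual values.\<close>

lemma deviation_le_mono_seqs:
  assumes "acc (P :: 'c::order set)" "deviation_le k P"
  shows "deviation_le (Suc k) (mono_seqs P)"
  using assms
proof (induction k arbitrary: P)
  case 0
  have "deviation_le 0 (mono_seqs P)"
    using 0 by (force simp: mono_seqs_def le_fun_def)
  then show ?case by (rule deviation_le_Suc)
next
  case (Suc k)
  show ?case
    unfolding deviation_le.simps(2)[of "Suc k"]
  proof (intro allI impI)
    fix s :: "nat \<Rightarrow> nat \<Rightarrow> 'c"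
    assume s: "\<forall>i. s i \<in> mono_seqs P \<and> s (Suc i) \<le> s i"
    have P: "s i n \<in> P" and mono: "mono (s i)" for i n using s by (simp_all add: mono_seqs_def)
    have "\<exists>M. \<forall>n\<ge>M. s i n = s i M" for i
      using accD[OF Suc.prems(1) P mono] .
    then obtain m where m: "\<And>i n. n \<ge> m i \<Longrightarrow> s i n = s i (m i)" by metis
    define l where "l i = s i (m i)" for i
    have l_le: "l (Suc i) \<le> l i" for i
    proof -
      have "s (Suc i) (max (m i) (m (Suc i))) \<le> s i (max (m i) (m (Suc i)))"
        using s by (simp add: le_fun_def)
      then show ?thesis
        using m[of i "max (m i) (m (Suc i))"] m[of "Suc i" "max (m i) (m (Suc i))"]
        by (simp add: l_def)
    qed
    have "l i \<in> P" for i using P by (simp add: l_def)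
    then have "\<forall>\<^sub>F i in sequentially. deviation_le k {x\<in>P. l (Suc i) \<le> x \<and> x \<le> l i}"
      using Suc.prems(2) l_le unfolding deviation_le.simps by blast
    then show "\<forall>\<^sub>F i in sequentially.
        deviation_le (Suc k) {x\<in>mono_seqs P. s (Suc i) \<le> x \<and> x \<le> s i}"
    proof eventually_elim
      case (elim i)
      define Q where "Q = {x\<in>P. l (Suc i) \<le> x \<and> x \<le> l i}"
      have Q: "deviation_le (Suc k) (mono_seqs Q)"
        by (rule Suc.IH) (use elim Suc.prems(1) in \<open>auto simp: Q_def intro: acc_subset\<close>)
      \<comment> \<open>From \<open>M\<close> on, \<open>s i\<close> and \<open>s (Suc i)\<close>
        are constant, so the tail of a sequence between them lies in \<open>mono_seqs Q\<close>. The
        first \<open>M\<close> entries are controlled by the hypothesis on \<open>P\<close>, the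
        tail by the induction hypothesis.\<close>
      define M where "M = max (m i) (m (Suc i))"
      have M: "s i (n + M) = l i" "s (Suc i) (n + M) = l (Suc i)" for n
        using m[of i "n + M"] m[of "Suc i" "n + M"] by (simp_all add: M_def l_def)
      show ?case
      proof (rule deviation_le_joint_map[OF deviation_le_finite_power[OF Suc.prems(2), of M] Q,
            of _ "\<lambda>x n. if n < M then x n else undefined" "\<lambda>x n. x (n + M)"])
        fix x assume x: "x \<in> {x \<in> mono_seqs P. s (Suc i) \<le> x \<and> x \<le> s i}"
        then show "(\<lambda>n. if n < M then x n else undefined)
            \<in> {s. (\<forall>n<M. s n \<in> P) \<and> (\<forall>n\<ge>M. s n = undefined)}"
          by (simp add: mono_seqs_def)
        have "l (Suc i) \<le> x (n + M)" "x (n + M) \<le> l i" for n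
          using x M[of n] by (auto simp: le_fun_def dest: spec[of _ "n + M"])
        then show "(\<lambda>n. x (n + M)) \<in> mono_seqs Q"
          using x by (simp add: mono_seqs_def Q_def mono_def)
      next
        fix x y :: "nat \<Rightarrow> 'c"
        assume eq: "(\<lambda>n. if n < M then x n else undefined) = (\<lambda>n. if n < M then y n else undefined)"
          "(\<lambda>n. x (n + M)) = (\<lambda>n. y (n + M))"
        show "x = y"
        proof
          fix n show "x n = y n"
            using fun_cong[OF eq(1), of n] fun_cong[OF eq(2), of "n - M"] by (cases "n < M") auto
        qed
      qed (auto simp: le_fun_def)
    qed
  qed
qed

text \<open>Splits an exact dimension into an upper and a lower bound, by monotonicity of deviation
  bounds in the index. \<open>krull_dim_poset\<close> gives \<open>enat 0\<close> both for deviation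
  minus infinity and for deviation 0; the hypothesis excludes the former.\<close>

lemma krull_dim_poset_eq_enat_iff:
  assumes "\<not> dev_le 0 P"
  shows "krull_dim_poset P = enat d \<longleftrightarrow> dev_le (Suc d) P \<and> \<not> dev_le d P"
proof
  assume L: "krull_dim_poset P = enat d"
  then have ex: "\<exists>k. dev_le (Suc k) P" and d: "d = (LEAST k. dev_le (Suc k) P)"
    by (auto simp: krull_dim_poset_def split: if_splits)
  have "dev_le (Suc d) P" unfolding d using ex by (rule LeastI_ex)
  moreover have "\<not> dev_le d P"
  proof (cases d)
    case (Suc k)
    then show ?thesis using not_less_Least[of k "\<lambda>k. dev_le (Suc k) P"] d by simp
  qed (use assms in simp)
  ultimately show "dev_le (Suc d) P \<and> \<not> dev_le d P" by blast
next
  assume R: "dev_le (Suc d) P \<and> \<not> dev_le d P"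
  then have "(LEAST k. dev_le (Suc k) P) = d"
    unfolding dev_le_eq_deviation_le
    by (intro Least_equality) (blast, meson deviation_le_mono not_less_eq_eq)
  then show "krull_dim_poset P = enat d" using R unfolding krull_dim_poset_def by metis
qed

section \<open>Right ideals of twisted group algebras\<close>

definition add_subgroup :: "'g::ab_group_add set \<Rightarrow> bool" where
  "add_subgroup G \<longleftrightarrow> 0 \<in> G \<and> (\<forall>a\<in>G. \<forall>b\<in>G. a - b \<in> G)"

lemma add_subgroup_0: "add_subgroup G \<Longrightarrow> 0 \<in> G"
  and add_subgroup_diff: "add_subgroup G \<Longrightarrow> a \<in> G \<Longrightarrow> b \<in> G \<Longrightarrow> a - b \<in> G"
  by (auto simp: add_subgroup_def)

lemma add_subgroup_minus: "add_subgroup G \<Longrightarrow> a \<in> G \<Longrightarrow> - a \<in> G"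
  using add_subgroup_diff[of G 0 a] add_subgroup_0 by auto

lemma add_subgroup_add: "add_subgroup G \<Longrightarrow> a \<in> G \<Longrightarrow> b \<in> G \<Longrightarrow> a + b \<in> G"
  using add_subgroup_diff[of G a "- b"] add_subgroup_minus by auto

lemma add_subgroup_diff_iff: "add_subgroup G \<Longrightarrow> b \<in> G \<Longrightarrow> a - b \<in> G \<longleftrightarrow> a \<in> G"
  using add_subgroup_diff add_subgroup_add[of G "a - b" b] by auto

text \<open>The cocycle identity at \<open>x\<close>, \<open>0\<close>, \<open>0\<close>. Cocycles
  are not normalised, so the basis element at \<open>0\<close> acts as the scalar
  \<open>\<tau> 0 0\<close> rather than as 1.\<close>

lemma cocycle_0_right:
  assumes "add_subgroup G" "cocycle G (+) \<tau>" "x \<in> G"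
  shows "\<tau> x 0 = \<tau> 0 0"
proof -
  have "\<tau> x 0 * \<tau> (x + 0) 0 = \<tau> 0 0 * \<tau> x (0 + 0)" "\<tau> x 0 \<noteq> 0"
    using assms add_subgroup_0 unfolding cocycle_def by blast+
  then show ?thesis by simp
qed

section \<open>Right ideals as subspaces stable under basis elements\<close>

definition smul :: "'a::field \<Rightarrow> ('g \<Rightarrow> 'a) \<Rightarrow> 'g \<Rightarrow> 'a" where
  "smul c f = (\<lambda>x. c * f x)"

text \<open>Right multiplication by the basis element indexed by \<open>b\<close>.\<close>

definition translate :: "('g::ab_group_add \<Rightarrow> 'g \<Rightarrow> 'a::field) \<Rightarrow> 'g \<Rightarrow> ('g \<Rightarrow> 'a) \<Rightarrow> 'g \<Rightarrow> 'a" where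
  "translate \<tau> b f = (\<lambda>x. f (x - b) * \<tau> (x - b) b)"

lemma sum_fun_apply: "sum h B x = (\<Sum>b\<in>B. h b x)"
  by (induction B rule: infinite_finite_induct) auto

text \<open>After swapping the sums, only \<open>a = x - b\<close> contributes for each
  \<open>b\<close>.\<close>

lemma tga_mult_eq_sum_translate:
  assumes "finite {x. f x \<noteq> 0}"
  shows "tga_mult (+) \<tau> f r = (\<Sum>b\<in>{y. r y \<noteq> 0}. smul (r b) (translate \<tau> b f))"
proof
  fix x
  have "tga_mult (+) \<tau> f r x =
      (\<Sum>b\<in>{y. r y \<noteq> 0}. \<Sum>a\<in>{x. f x \<noteq> 0}. if a + b = x then f a * r b * \<tau> a b else 0)"
    unfolding tga_mult_def by (rule sum.swap)
  also have "\<dots> = (\<Sum>b\<in>{y. r y \<noteq> 0}. smul (r b) (translate \<tau> b f) x)"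
  proof (rule sum.cong[OF refl])
    fix b
    have "(\<Sum>a\<in>{x. f x \<noteq> 0}. if a + b = x then f a * r b * \<tau> a b else 0)
        = (\<Sum>a\<in>{x. f x \<noteq> 0}. if a = x - b then f a * r b * \<tau> a b else 0)"
      by (rule sum.cong) (auto simp: algebra_simps)
    also have "\<dots> = smul (r b) (translate \<tau> b f) x"
      using assms by (simp add: sum.delta smul_def translate_def)
    finally show "(\<Sum>a\<in>{x. f x \<noteq> 0}. if a + b = x then f a * r b * \<tau> a b else 0)
        = smul (r b) (translate \<tau> b f) x" .
  qed
  also have "\<dots> = (\<Sum>b\<in>{y. r y \<noteq> 0}. smul (r b) (translate \<tau> b f)) x"
    by (simp add: sum_fun_apply)
  finally show "tga_mult (+) \<tau> f r x = (\<Sum>b\<in>{y. r y \<noteq> 0}. smul (r b) (translate \<tau> b f)) x" .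
qed

lemma tga_carrier_zero: "0 \<in> tga_carrier G"
  by (simp add: tga_carrier_def)

lemma tga_carrier_add:
  assumes "f \<in> tga_carrier G" "g \<in> tga_carrier G" shows "f + g \<in> tga_carrier G"
proof -
  have "{x. (f + g) x \<noteq> 0} \<subseteq> {x. f x \<noteq> 0} \<union> {x. g x \<noteq> 0}" by auto
  moreover have "finite ({x. f x \<noteq> 0} \<union> {x. g x \<noteq> 0})"
    using assms by (simp add: tga_carrier_def)
  ultimately have "finite {x. (f + g) x \<noteq> 0}" by (rule finite_subset)
  then show ?thesis using assms unfolding tga_carrier_def by force
qed

lemma tga_carrier_smul:
  assumes "f \<in> tga_carrier G" shows "smul c f \<in> tga_carrier G"
proof -
  have "{x. smul c f x \<noteq> 0} \<subseteq> {x. f x \<noteq> 0}" by (auto simp: smul_def)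
  then show ?thesis using assms finite_subset unfolding tga_carrier_def by fastforce
qed

lemma tga_carrier_translate:
  assumes "add_subgroup G" "b \<in> G" "f \<in> tga_carrier G"
  shows "translate \<tau> b f \<in> tga_carrier G"
proof -
  have "{x. translate \<tau> b f x \<noteq> 0} \<subseteq> (\<lambda>x. x + b) ` {x. f x \<noteq> 0}"
    by (auto simp: translate_def image_iff intro!: exI[of _ "_ - b"])
  moreover have "finite ((\<lambda>x. x + b) ` {x. f x \<noteq> 0})" using assms(3) by (simp add: tga_carrier_def)
  ultimately have "finite {x. translate \<tau> b f x \<noteq> 0}" by (rule finite_subset)
  then show ?thesis using assms
    by (auto simp: tga_carrier_def translate_def add_subgroup_diff_iff)
qed

text \<open>Scalar multiples of basis elements span the algebra, so closure under products need only
  be tested on scalars and on basis elements.\<close>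

lemma right_ideals_iff:
  assumes G: "add_subgroup G" and co: "cocycle G (+) \<tau>"
  shows "I \<in> right_ideals G (+) \<tau> \<longleftrightarrow>
    I \<subseteq> tga_carrier G \<and> 0 \<in> I \<and> (\<forall>f\<in>I. \<forall>g\<in>I. f + g \<in> I) \<and>
    (\<forall>f\<in>I. \<forall>c. smul c f \<in> I) \<and> (\<forall>f\<in>I. \<forall>b\<in>G. translate \<tau> b f \<in> I)" (is "_ \<longleftrightarrow> ?R")
proof
  assume L: "I \<in> right_ideals G (+) \<tau>"
  then have sub: "I \<subseteq> tga_carrier G" and zero: "0 \<in> I"
    and add: "f \<in> I \<Longrightarrow> g \<in> I \<Longrightarrow> f + g \<in> I"
    and mult: "f \<in> I \<Longrightarrow> r \<in> tga_carrier G \<Longrightarrow> tga_mult (+) \<tau> f r \<in> I" for f g r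
    by (auto simp: right_ideals_def tga_add_def zero_fun_def plus_fun_def)
  have monom: "smul c (translate \<tau> b f) \<in> I" if f: "f \<in> I" and b: "b \<in> G" for f b c
  proof (cases "c = 0")
    case True
    then show ?thesis using zero by (simp add: smul_def zero_fun_def)
  next
    case False
    \<comment> \<open>The one-term element with coefficient \<open>c\<close> at
      \<open>b\<close>.\<close>
    let ?r = "\<lambda>x. if x = b then c else 0"
    have supp: "{y. ?r y \<noteq> 0} = {b}" using False by auto
    then have "?r \<in> tga_carrier G" using b by (auto simp: tga_carrier_def)
    moreover have "tga_mult (+) \<tau> f ?r = smul c (translate \<tau> b f)"
      using f sub by (subst tga_mult_eq_sum_translate) (auto simp: tga_carrier_def supp)
    ultimately show ?thesis using mult[OF f] by metis
  qed
  have "smul c f \<in> I" if f: "f \<in> I" for f c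
  proof -
    have 0: "0 \<in> G" using G by (rule add_subgroup_0)
    have nz: "\<tau> 0 0 \<noteq> 0" using co 0 unfolding cocycle_def by blast
    \<comment> \<open>Dividing by \<open>\<tau> 0 0\<close> corrects for the unnormalised cocycle,
      so scalars are recovered from the basis element at \<open>0\<close>.\<close>
    have "smul (c / \<tau> 0 0) (translate \<tau> 0 f) = smul c f"
    proof
      fix x
      have "f x = 0 \<or> x \<in> G" using f sub by (auto simp: tga_carrier_def)
      then show "smul (c / \<tau> 0 0) (translate \<tau> 0 f) x = smul c f x"
        using nz cocycle_0_right[OF G co] by (auto simp: smul_def translate_def)
    qed
    then show ?thesis using monom[OF f 0] by metis
  qed
  moreover have "translate \<tau> b f \<in> I" if "f \<in> I" "b \<in> G" for f b
    using monom[OF that, of 1] by (simp add: smul_def)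
  ultimately show ?R using sub zero add by blast
next
  assume R: ?R
  have "tga_mult (+) \<tau> f r \<in> I" if f: "f \<in> I" and r: "r \<in> tga_carrier G" for f r
  proof -
    have "(\<Sum>b\<in>B. smul (r b) (translate \<tau> b f)) \<in> I" if "B \<subseteq> G" for B
      using that by (induction B rule: infinite_finite_induct) (use R f in auto)
    moreover have "{y. r y \<noteq> 0} \<subseteq> G" "finite {x. f x \<noteq> 0}"
      using r f R by (auto simp: tga_carrier_def)
    ultimately show ?thesis by (simp add: tga_mult_eq_sum_translate)
  qed
  then show "I \<in> right_ideals G (+) \<tau>" using R
    by (auto simp: right_ideals_def tga_add_def zero_fun_def plus_fun_def)
qed

lemma right_idealI:
  assumes "add_subgroup G" "cocycle G (+) \<tau>" "I \<subseteq> tga_carrier G" "0 \<in> I"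
    and "\<And>f g. f \<in> I \<Longrightarrow> g \<in> I \<Longrightarrow> f + g \<in> I"
    and "\<And>c f. f \<in> I \<Longrightarrow> smul c f \<in> I"
    and "\<And>b f. f \<in> I \<Longrightarrow> b \<in> G \<Longrightarrow> translate \<tau> b f \<in> I"
  shows "I \<in> right_ideals G (+) \<tau>"
  using assms by (simp add: right_ideals_iff)

lemma right_idealD:
  assumes "add_subgroup G" "cocycle G (+) \<tau>" "I \<in> right_ideals G (+) \<tau>"
  shows "I \<subseteq> tga_carrier G" "0 \<in> I"
    and "f \<in> I \<Longrightarrow> g \<in> I \<Longrightarrow> f + g \<in> I"
    and "f \<in> I \<Longrightarrow> smul c f \<in> I"
    and "f \<in> I \<Longrightarrow> b \<in> G \<Longrightarrow> translate \<tau> b f \<in> I"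
  using assms by (simp_all add: right_ideals_iff)

lemma right_ideal_diff:
  assumes "add_subgroup G" "cocycle G (+) \<tau>" "I \<in> right_ideals G (+) \<tau>" "f \<in> I" "g \<in> I"
  shows "f - g \<in> I"
proof -
  have "f - g = f + smul (-1) g" by (auto simp: smul_def)
  then show ?thesis using right_idealD(3,4)[OF assms(1-3)] assms(4,5) by metis
qed

lemma zero_right_ideal: "add_subgroup G \<Longrightarrow> cocycle G (+) \<tau> \<Longrightarrow> {0} \<in> right_ideals G (+) \<tau>"
  by (rule right_idealI) (auto simp: tga_carrier_zero smul_def translate_def)

lemma carrier_right_ideal:
  "add_subgroup G \<Longrightarrow> cocycle G (+) \<tau> \<Longrightarrow> tga_carrier G \<in> right_ideals G (+) \<tau>"
  by (rule right_idealI)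
    (auto intro: tga_carrier_zero tga_carrier_add tga_carrier_smul tga_carrier_translate)

lemma right_ideals_not_deviation_le_0:
  assumes "add_subgroup G" "cocycle G (+) (\<tau> :: 'g::ab_group_add \<Rightarrow> 'g \<Rightarrow> 'a::field)"
  shows "\<not> deviation_le 0 (right_ideals G (+) \<tau>)"
proof -
  let ?f = "\<lambda>x::'g. if x = 0 then 1 else 0 :: 'a"
  have "?f \<in> tga_carrier G" using add_subgroup_0[OF assms(1)] by (auto simp: tga_carrier_def)
  moreover have "?f \<noteq> 0" by (auto dest: fun_cong[of _ _ 0])
  ultimately have "{0} \<noteq> (tga_carrier G :: ('g \<Rightarrow> 'a) set)" by blast
  moreover have "{0} \<subseteq> (tga_carrier G :: ('g \<Rightarrow> 'a) set)" using tga_carrier_zero by simp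
  ultimately show ?thesis
    using zero_right_ideal[OF assms] carrier_right_ideal[OF assms]
    unfolding deviation_le.simps by meson
qed

text \<open>Basis elements are units, by the cocycle identity at \<open>x\<close>, \<open>b\<close>,
  \<open>- b\<close>. Hence an element can be shifted to any degree without affecting its membership
  in a right ideal.\<close>

lemma translate_cancel:
  assumes "add_subgroup G" "cocycle G (+) \<tau>" "f \<in> tga_carrier G" "b \<in> G"
  shows "translate \<tau> (- b) (translate \<tau> b f) = smul (\<tau> b (- b) * \<tau> 0 0) f"
proof
  fix x
  show "translate \<tau> (- b) (translate \<tau> b f) x = smul (\<tau> b (- b) * \<tau> 0 0) f x"
  proof (cases "x \<in> G")
    case True
    have "\<tau> x b * \<tau> (x + b) (- b) = \<tau> b (- b) * \<tau> x (b + - b)"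
      using assms(2,4) True add_subgroup_minus[OF assms(1,4)] unfolding cocycle_def by blast
    then show ?thesis using cocycle_0_right[OF assms(1,2) True]
      by (simp add: translate_def smul_def mult.assoc)
  next
    case False
    then show ?thesis using assms(3) by (auto simp: tga_carrier_def translate_def smul_def)
  qed
qed

lemma right_ideal_translate_cancel:
  assumes "add_subgroup G" "cocycle G (+) \<tau>" "I \<in> right_ideals G (+) \<tau>"
    "f \<in> tga_carrier G" "b \<in> G" "translate \<tau> b f \<in> I"
  shows "f \<in> I"
proof -
  let ?c = "\<tau> b (- b) * \<tau> 0 0"
  have mb: "- b \<in> G" using add_subgroup_minus[OF assms(1,5)] .
  have nz: "?c \<noteq> 0"
    using assms(2,5) mb add_subgroup_0[OF assms(1)] unfolding cocycle_def by simp
  have "smul ?c f \<in> I"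
    using right_idealD(5)[OF assms(1-3,6) mb] translate_cancel[OF assms(1,2,4,5)] by simp
  then have "smul (1 / ?c) (smul ?c f) \<in> I" by (rule right_idealD(4)[OF assms(1-3)])
  moreover have "smul (1 / ?c) (smul ?c f) = f" using nz by (auto simp: smul_def)
  ultimately show ?thesis by simp
qed

text \<open>Pulling functions back along \<open>\<psi>\<close> carries right ideals to right ideals; rescaling a cocycle by a
  constant does not change the right ideals.\<close>

lemma right_ideals_pullback:
  fixes \<psi> :: "'h::ab_group_add \<Rightarrow> 'g::ab_group_add"
    and \<tau> :: "'g \<Rightarrow> 'g \<Rightarrow> 'a::field" and \<tau>' :: "'h \<Rightarrow> 'h \<Rightarrow> 'a"
  assumes K: "add_subgroup K" "cocycle K (+) \<tau>" and K': "add_subgroup K'" "cocycle K' (+) \<tau>'"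
    and diff: "\<And>a b. \<psi> (a - b) = \<psi> a - \<psi> b" and inj: "inj \<psi>"
    and mem: "\<And>y. \<psi> y \<in> K \<longleftrightarrow> y \<in> K'" and surj: "K \<subseteq> range \<psi>"
    and c: "c \<noteq> 0" "\<And>a b. a \<in> K' \<Longrightarrow> b \<in> K' \<Longrightarrow> \<tau> (\<psi> a) (\<psi> b) = c * \<tau>' a b"
  shows "acc (right_ideals K' (+) \<tau>') \<Longrightarrow> acc (right_ideals K (+) \<tau>)"
    and "deviation_le k (right_ideals K' (+) \<tau>') \<Longrightarrow> deviation_le k (right_ideals K (+) \<tau>)"
proof -
  define F where "F = (\<lambda>f::'g \<Rightarrow> 'a. f \<circ> \<psi>)"
  have F_carrier: "F f \<in> tga_carrier K'" if "f \<in> tga_carrier K" for f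
  proof -
    have "finite (\<psi> -` {x. f x \<noteq> 0})"
      using that inj by (intro finite_vimageI) (auto simp: tga_carrier_def)
    moreover have "\<psi> -` {x. f x \<noteq> 0} = {y. f (\<psi> y) \<noteq> 0}" by auto
    ultimately show ?thesis using that mem by (auto simp: tga_carrier_def F_def)
  qed
  have F_inj: "inj_on F (tga_carrier K)"
  proof (rule inj_onI, rule ext)
    fix f g x assume *: "f \<in> tga_carrier K" "g \<in> tga_carrier K" "F f = F g"
    show "f x = g x"
    proof (cases "x \<in> K")
      case True
      then obtain y where "x = \<psi> y" using surj by blast
      then show ?thesis using fun_cong[OF *(3), of y] by (simp add: F_def)
    next
      case False
      then have "f x = 0" "g x = 0" using *(1,2) by (auto simp: tga_carrier_def)
      then show ?thesis by simp
    qed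
  qed
  have ideal: "F ` I \<in> right_ideals K' (+) \<tau>'" if I: "I \<in> right_ideals K (+) \<tau>" for I
  proof (rule right_idealI[OF K'])
    note D = right_idealD[OF K I]
    show "F ` I \<subseteq> tga_carrier K'" using F_carrier D(1) by blast
    have "F 0 = 0" by (auto simp: F_def)
    then show "0 \<in> F ` I" using D(2) by (metis imageI)
    fix f' assume "f' \<in> F ` I"
    then obtain f where f: "f \<in> I" "f' = F f" by blast
    have "smul d f' = F (smul d f)" for d by (auto simp: F_def f smul_def)
    then show "smul d f' \<in> F ` I" for d using D(4)[OF f(1)] by blast
    show "f' + g' \<in> F ` I" if g': "g' \<in> F ` I" for g'
    proof -
      obtain g where g: "g \<in> I" "g' = F g" using g' by blast
      have "f' + g' = F (f + g)" by (auto simp: F_def f g)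
      then show ?thesis using D(3)[OF f(1) g(1)] by blast
    qed
    show "translate \<tau>' b f' \<in> F ` I" if b: "b \<in> K'" for b
    proof -
      \<comment> \<open>The factor \<open>1 / c\<close> undoes the rescaling of the cocycle. The two
        cocycles are compared on \<open>K'\<close> only, but outside it the pulled back function
        vanishes.\<close>
      have "translate \<tau>' b f' = F (smul (1 / c) (translate \<tau> (\<psi> b) f))"
      proof
        fix y
        have "f (\<psi> (y - b)) = 0 \<or> y - b \<in> K'"
          using D(1) f(1) mem by (auto simp: tga_carrier_def)
        then show "translate \<tau>' b f' y = F (smul (1 / c) (translate \<tau> (\<psi> b) f)) y"
          using c(1) c(2)[OF _ b, of "y - b"]
          by (auto simp: translate_def F_def f smul_def diff)
      qed
      then show ?thesis using D(4)[OF D(5)[OF f(1)]] mem b by blast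
    qed
  qed
  have inj': "I = J"
    if "I \<in> right_ideals K (+) \<tau>" "J \<in> right_ideals K (+) \<tau>" "F ` I = F ` J" for I J
    using inj_on_image_eq_iff[OF F_inj] right_idealD(1)[OF K] that by blast
  show "acc (right_ideals K' (+) \<tau>') \<Longrightarrow> acc (right_ideals K (+) \<tau>)"
    by (erule acc_map[of _ _ "image F"]) (use ideal inj' in \<open>blast+\<close>)
  show "deviation_le k (right_ideals K' (+) \<tau>') \<Longrightarrow> deviation_le k (right_ideals K (+) \<tau>)"
    by (erule deviation_le_map[of _ _ _ "image F"]) (use ideal inj' in \<open>blast+\<close>)
qed

section \<open>Extending the group by an infinite cyclic group\<close>

definition degree0_part :: "('g \<Rightarrow> int) \<Rightarrow> ('g \<Rightarrow> 'a::field) \<Rightarrow> 'g \<Rightarrow> 'a" where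
  "degree0_part \<phi> f = (\<lambda>x. if \<phi> x = 0 then f x else 0)"

text \<open>The leading coefficients of the elements of \<open>I\<close> whose degrees lie in an interval of length \<open>n\<close>;
  multiplying by a basis element, one may take \<open>0\<close> as the right end of that interval.\<close>

definition leading_coeffs :: "('g \<Rightarrow> int) \<Rightarrow> ('g \<Rightarrow> 'a::field) set \<Rightarrow> nat \<Rightarrow> ('g \<Rightarrow> 'a) set" where
  "leading_coeffs \<phi> I n =
     degree0_part \<phi> ` {f\<in>I. \<forall>x. f x \<noteq> 0 \<longrightarrow> - int n \<le> \<phi> x \<and> \<phi> x \<le> 0}"

text \<open>A degree homomorphism onto the integers makes the algebra of \<open>K\<close> a skew
  Laurent extension of the algebra of the kernel.\<close>

locale graded_twisted_group_algebra =
  fixes K :: "'g::ab_group_add set" and \<tau> :: "'g \<Rightarrow> 'g \<Rightarrow> 'a::field" and \<phi> :: "'g \<Rightarrow> int"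
  assumes K: "add_subgroup K" and co: "cocycle K (+) \<tau>"
    and \<phi>_diff: "\<phi> (x - y) = \<phi> x - \<phi> y" and \<phi>_surj: "\<exists>b\<in>K. \<phi> b = n"
begin

definition H :: "'g set" where
  "H = {x\<in>K. \<phi> x = 0}"

lemma H_subgroup: "add_subgroup H"
proof -
  have "\<phi> 0 = 0" using \<phi>_diff[of 0 0] by simp
  then show ?thesis using K by (simp add: H_def add_subgroup_def \<phi>_diff)
qed

lemma H_cocycle: "cocycle H (+) \<tau>"
  using co by (simp add: cocycle_def H_def)

text \<open>Basis elements indexed by \<open>H\<close> have degree 0, so multiplication by them
  preserves the degree window and commutes with taking the degree 0 part.\<close>

lemma leading_coeffs_right_ideal:
  assumes I: "I \<in> right_ideals K (+) \<tau>"
  shows "leading_coeffs \<phi> I n \<in> right_ideals H (+) \<tau>"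
proof (rule right_idealI[OF H_subgroup H_cocycle])
  note D = right_idealD[OF K co I]
  define S where "S = {f\<in>I. \<forall>x. f x \<noteq> 0 \<longrightarrow> - int n \<le> \<phi> x \<and> \<phi> x \<le> 0}"
  have L: "leading_coeffs \<phi> I n = degree0_part \<phi> ` S" by (simp add: leading_coeffs_def S_def)
  show "leading_coeffs \<phi> I n \<subseteq> tga_carrier H"
  proof
    fix f' assume "f' \<in> leading_coeffs \<phi> I n"
    then obtain f where f: "f \<in> I" "f' = degree0_part \<phi> f" by (auto simp: leading_coeffs_def)
    then have f_carrier: "f \<in> tga_carrier K" using D(1) by blast
    moreover have "{x. f' x \<noteq> 0} \<subseteq> {x. f x \<noteq> 0}" by (auto simp: f degree0_part_def)
    ultimately have "finite {x. f' x \<noteq> 0}" unfolding tga_carrier_def by (blast intro: finite_subset)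
    then show "f' \<in> tga_carrier H"
      using f_carrier by (auto simp: tga_carrier_def H_def f degree0_part_def)
  qed
  have "0 \<in> S" "degree0_part \<phi> 0 = (0 :: 'g \<Rightarrow> 'a)"
    using D(2) by (auto simp: S_def degree0_part_def)
  then show "0 \<in> leading_coeffs \<phi> I n" unfolding L by (metis imageI)
  fix f' assume "f' \<in> leading_coeffs \<phi> I n"
  then obtain f where f: "f \<in> S" "f' = degree0_part \<phi> f" unfolding L by blast
  show "f' + g' \<in> leading_coeffs \<phi> I n" if g': "g' \<in> leading_coeffs \<phi> I n" for g'
  proof -
    obtain g where g: "g \<in> S" "g' = degree0_part \<phi> g" using g' L by blast
    have "f x \<noteq> 0 \<or> g x \<noteq> 0" if "(f + g) x \<noteq> 0" for x using that by auto
    then have "f + g \<in> S" using f(1) g(1) D(3)[of f g] unfolding S_def by blast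
    moreover have "f' + g' = degree0_part \<phi> (f + g)" by (auto simp: f g degree0_part_def)
    ultimately show ?thesis unfolding L by blast
  qed
  show "smul c f' \<in> leading_coeffs \<phi> I n" for c
  proof -
    have "smul c f \<in> S" using f(1) D(4)[of f c] by (auto simp: S_def smul_def)
    moreover have "smul c f' = degree0_part \<phi> (smul c f)" by (auto simp: f degree0_part_def smul_def)
    ultimately show ?thesis unfolding L by blast
  qed
  show "translate \<tau> b f' \<in> leading_coeffs \<phi> I n" if "b \<in> H" for b
  proof -
    have b: "b \<in> K" "\<phi> (x - b) = \<phi> x" for x using that by (simp_all add: H_def \<phi>_diff)
    have "- int n \<le> \<phi> x \<and> \<phi> x \<le> 0" if "translate \<tau> b f x \<noteq> 0" for x
      using f(1) b(2)[of x] that unfolding S_def translate_def by fastforce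
    then have "translate \<tau> b f \<in> S" using f(1) D(5)[of f b] b(1) by (simp add: S_def)
    moreover have "translate \<tau> b f' = degree0_part \<phi> (translate \<tau> b f)"
      by (auto simp: f degree0_part_def translate_def b)
    ultimately show ?thesis unfolding L by blast
  qed
qed

lemma leading_coeffs_mono_seq:
  assumes "I \<in> right_ideals K (+) \<tau>"
  shows "leading_coeffs \<phi> I \<in> mono_seqs (right_ideals H (+) \<tau>)"
proof -
  have "mono (leading_coeffs \<phi> I)"
    unfolding leading_coeffs_def mono_def by (intro allI impI image_mono) force
  then show ?thesis using leading_coeffs_right_ideal[OF assms] by (simp add: mono_seqs_def)
qed

lemma leading_coeffs_mono: "I \<subseteq> J \<Longrightarrow> leading_coeffs \<phi> I \<le> leading_coeffs \<phi> J"
  by (auto simp: le_fun_def leading_coeffs_def)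

text \<open>A division algorithm: shift the top degree of an element of \<open>J\<close> to 0,
  subtract an element of \<open>I\<close> with the same leading part and no longer window, and
  continue with fewer degrees.\<close>

lemma leading_coeffs_determine:
  assumes I: "I \<in> right_ideals K (+) \<tau>" and J: "J \<in> right_ideals K (+) \<tau>"
    and sub: "I \<subseteq> J" and eq: "leading_coeffs \<phi> I = leading_coeffs \<phi> J"
  shows "I = J"
proof -
  \<comment> \<open>The window contains exactly \<open>n\<close> degrees; for \<open>n = 0\<close>
    it is empty and \<open>f\<close> is zero.\<close>
  have main: "f \<in> I" if "f \<in> J" "\<And>x. f x \<noteq> 0 \<Longrightarrow> M - int n < \<phi> x \<and> \<phi> x \<le> M" for f M n
    using that
  proof (induction n arbitrary: f M)
    case 0
    then have "f = 0" by force
    then show ?case using right_idealD(2)[OF K co I] by metis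
  next
    case (Suc n)
    \<comment> \<open>Multiplication by this basis element moves the right end \<open>M\<close> of
      the window to 0.\<close>
    obtain b where b: "b \<in> K" "\<phi> b = - M" using \<phi>_surj by blast
    define f' where "f' = translate \<tau> b f"
    have f'J: "f' \<in> J" unfolding f'_def by (rule right_idealD(5)[OF K co J Suc.prems(1) b(1)])
    have supp: "- int n \<le> \<phi> x \<and> \<phi> x \<le> 0" if "f' x \<noteq> 0" for x
    proof -
      have "f (x - b) \<noteq> 0" using that by (auto simp: f'_def translate_def)
      from Suc.prems(2)[OF this] show ?thesis by (simp add: \<phi>_diff b(2))
    qed
    then have "degree0_part \<phi> f' \<in> leading_coeffs \<phi> J n" using f'J by (auto simp: leading_coeffs_def)
    then have "degree0_part \<phi> f' \<in> leading_coeffs \<phi> I n" using eq by simp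
    then obtain g where g: "g \<in> I" "\<And>x. g x \<noteq> 0 \<Longrightarrow> - int n \<le> \<phi> x \<and> \<phi> x \<le> 0"
      "degree0_part \<phi> f' = degree0_part \<phi> g"
      by (auto simp: leading_coeffs_def)
    have "f' - g \<in> J" using right_ideal_diff[OF K co J f'J] g(1) sub by blast
    \<comment> \<open>The subtraction has removed degree 0, leaving the \<open>n\<close> degrees
      from \<open>- n\<close> to \<open>-1\<close>.\<close>
    moreover have "-1 - int n < \<phi> x \<and> \<phi> x \<le> -1" if "(f' - g) x \<noteq> 0" for x
    proof -
      have "f' x \<noteq> 0 \<or> g x \<noteq> 0" using that by auto
      then have "- int n \<le> \<phi> x \<and> \<phi> x \<le> 0" using supp g(2) by blast
      moreover have "\<phi> x \<noteq> 0" using fun_cong[OF g(3), of x] that by (auto simp: degree0_part_def)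
      ultimately show ?thesis by linarith
    qed
    ultimately have "f' - g \<in> I" by (rule Suc.IH)
    then have "f' - g + g \<in> I" using g(1) by (rule right_idealD(3)[OF K co I])
    then have "f' \<in> I" by simp
    then show ?case unfolding f'_def
      using right_ideal_translate_cancel[OF K co I _ b(1)] Suc.prems(1) right_idealD(1)[OF K co J]
      by blast
  qed
  have "f \<in> I" if f: "f \<in> J" for f
  proof -
    have fin: "finite {x. f x \<noteq> 0}" using right_idealD(1)[OF K co J] f by (auto simp: tga_carrier_def)
    \<comment> \<open>\<open>B\<close> bounds all absolute degrees in the finite support, so
      \<open>2 * B + 1\<close> degrees ending at \<open>B\<close> cover it.\<close>
    define B where "B = (\<Sum>x\<in>{x. f x \<noteq> 0}. nat \<bar>\<phi> x\<bar>)"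
    have "nat \<bar>\<phi> x\<bar> \<le> B" if "f x \<noteq> 0" for x
      unfolding B_def by (rule member_le_sum[of x _ "\<lambda>x. nat \<bar>\<phi> x\<bar>"]) (use fin that in auto)
    then show ?thesis by (intro main[OF f, of "int B" "2 * B + 1"]) force
  qed
  then show ?thesis using sub by blast
qed

text \<open>Both facts about \<open>mono_seqs\<close> are pulled back along
  \<open>leading_coeffs \<phi>\<close>, which is strictly monotone on right ideals.\<close>

lemma deviation_le_extension:
  assumes "acc (right_ideals H (+) \<tau>)"
  shows "acc (right_ideals K (+) \<tau>)"
    and "deviation_le k (right_ideals H (+) \<tau>) \<Longrightarrow> deviation_le (Suc k) (right_ideals K (+) \<tau>)"
proof -
  show "acc (right_ideals K (+) \<tau>)"
    by (rule acc_map[OF acc_mono_seqs[OF assms], of _ "leading_coeffs \<phi>"])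
      (simp_all add: leading_coeffs_mono_seq leading_coeffs_mono leading_coeffs_determine)
  show "deviation_le (Suc k) (right_ideals K (+) \<tau>)" if "deviation_le k (right_ideals H (+) \<tau>)"
    by (rule deviation_le_map[OF deviation_le_mono_seqs[OF assms that], of _ "leading_coeffs \<phi>"])
      (simp_all add: leading_coeffs_mono_seq leading_coeffs_mono leading_coeffs_determine)
qed

end

section \<open>Tensor products\<close>

lemma add_subgroup_Times: "add_subgroup G \<Longrightarrow> add_subgroup H \<Longrightarrow> add_subgroup (G \<times> H)"
  by (auto simp: add_subgroup_def zero_prod_def)

lemma cocycle_tensor:
  assumes "cocycle G (+) \<tau>1" "cocycle H (+) \<tau>2"
  shows "cocycle (G \<times> H) (+) (tensor_cocycle \<tau>1 \<tau>2)"
  unfolding cocycle_def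
proof (intro conjI ballI)
  fix a b assume "a \<in> G \<times> H" "b \<in> G \<times> H"
  then show "tensor_cocycle \<tau>1 \<tau>2 a b \<noteq> 0"
    using assms by (auto simp: cocycle_def tensor_cocycle_def)
next
  fix a b c assume "a \<in> G \<times> H" "b \<in> G \<times> H" "c \<in> G \<times> H"
  then have "\<tau>1 (fst a) (fst b) * \<tau>1 (fst a + fst b) (fst c) =
        \<tau>1 (fst b) (fst c) * \<tau>1 (fst a) (fst b + fst c)"
    "\<tau>2 (snd a) (snd b) * \<tau>2 (snd a + snd b) (snd c) =
        \<tau>2 (snd b) (snd c) * \<tau>2 (snd a) (snd b + snd c)"
    using assms by (auto simp: cocycle_def)
  then show "tensor_cocycle \<tau>1 \<tau>2 a b * tensor_cocycle \<tau>1 \<tau>2 (a + b) c =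
      tensor_cocycle \<tau>1 \<tau>2 b c * tensor_cocycle \<tau>1 \<tau>2 a (b + c)"
    unfolding tensor_cocycle_def fst_add snd_add by algebra
qed

section \<open>Linear forms on function spaces\<close>

definition linear_form :: "(('g \<Rightarrow> 'a::field) \<Rightarrow> 'a) \<Rightarrow> bool" where
  "linear_form L \<longleftrightarrow> (\<forall>f g. L (f + g) = L f + L g) \<and> (\<forall>c f. L (smul c f) = c * L f)"

lemma linear_form_add: "linear_form L \<Longrightarrow> L (f + g) = L f + L g"
  and linear_form_smul: "linear_form L \<Longrightarrow> L (smul c f) = c * L f"
  by (simp_all add: linear_form_def)

lemma linear_form_zero: "linear_form L \<Longrightarrow> L 0 = 0"
  using linear_form_smul[of L 0 0] by (simp add: smul_def zero_fun_def)

text \<open>A basis of \<open>I\<close> stays independent when \<open>h\<close> is added; send the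
  basis to 0 and \<open>h\<close> to 1, and extend linearly.\<close>

lemma separating_linear_form:
  fixes I :: "('g \<Rightarrow> 'a::field) set"
  assumes "0 \<in> I" "\<And>f g. f \<in> I \<Longrightarrow> g \<in> I \<Longrightarrow> f + g \<in> I" "\<And>c f. f \<in> I \<Longrightarrow> smul c f \<in> I"
    and "h \<notin> I"
  obtains L where "linear_form L" "\<And>f. f \<in> I \<Longrightarrow> L f = 0" "L h = 1"
proof -
  interpret vector_space_pair "smul :: 'a \<Rightarrow> ('g \<Rightarrow> 'a) \<Rightarrow> 'g \<Rightarrow> 'a" "(*) :: 'a \<Rightarrow> 'a \<Rightarrow> 'a"
    by unfold_locales (auto simp: smul_def algebra_simps)
  have sub: "vs1.subspace I" using assms(1-3) by (simp add: vs1.subspace_def)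
  obtain B where B: "B \<subseteq> I" "vs1.independent B" "I \<subseteq> vs1.span B"
    using vs1.maximal_independent_subset[of I] by blast
  have span: "vs1.span B \<subseteq> I" using B(1) sub by (rule vs1.span_minimal)
  then have "vs1.independent (insert h B)"
    using B(2) assms(4) by (intro vs1.independent_insertI) auto
  then obtain L where L: "Vector_Spaces.linear smul (*) L"
    "\<forall>x\<in>insert h B. L x = (if x = h then 1 else 0)"
    using linear_independent_extend[of "insert h B" "\<lambda>x. if x = h then 1 else 0"] by blast
  have "h \<notin> B" using B(1) assms(4) by blast
  then have "L f = 0" if "f \<in> B" for f using L(2) that by auto
  then have "L f = 0" if "f \<in> I" for f using linear_eq_0_on_span[OF L(1)] B(3) that by blast
  moreover have "linear_form L"
    using linear_add[OF L(1)] linear_scale[OF L(1)] by (simp add: linear_form_def)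
  moreover have "L h = 1" using L(2) by simp
  ultimately show ?thesis using that by blast
qed

section \<open>The lower bound for the dimension of the tensor product\<close>

locale tensor_twisted_group_algebras =
  fixes G :: "'g::ab_group_add set" and H :: "'h::ab_group_add set"
    and \<tau>1 :: "'g \<Rightarrow> 'g \<Rightarrow> 'a::field" and \<tau>2 :: "'h \<Rightarrow> 'h \<Rightarrow> 'a"
  assumes G: "add_subgroup G" "cocycle G (+) \<tau>1" and H: "add_subgroup H" "cocycle H (+) \<tau>2"
begin

abbreviation "R1 \<equiv> right_ideals G (+) \<tau>1"
abbreviation "R2 \<equiv> right_ideals H (+) \<tau>2"
abbreviation "T \<equiv> right_ideals (G \<times> H) (+) (tensor_cocycle \<tau>1 \<tau>2)"

lemmas GH = add_subgroup_Times[OF G(1) H(1)] cocycle_tensor[OF G(2) H(2)]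

text \<open>Views an element of the tensor product as a family of elements of \<open>F * G\<close>
  indexed by \<open>H\<close>.\<close>

definition slice :: "('g \<times> 'h \<Rightarrow> 'a) \<Rightarrow> 'h \<Rightarrow> 'g \<Rightarrow> 'a" where
  "slice f y = (\<lambda>x. f (x, y))"

lemma slice_zero: "slice 0 y = 0"
  and slice_add: "slice (f + g) y = slice f y + slice g y"
  and slice_smul: "slice (smul c f) y = smul c (slice f y)"
  by (auto simp: slice_def smul_def)

lemma slice_translate:
  "slice (translate (tensor_cocycle \<tau>1 \<tau>2) b f) y =
     smul (\<tau>2 (y - snd b) (snd b)) (translate \<tau>1 (fst b) (slice f (y - snd b)))"
  by (cases b) (auto simp: slice_def smul_def translate_def tensor_cocycle_def)

text \<open>The right ideal \<open>I' \<otimes> (F * H) + I \<otimes> J\<close>, described by functionals so that no tensor has to be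
  decomposed.\<close>

definition mixed :: "('g \<Rightarrow> 'a) set \<Rightarrow> ('g \<Rightarrow> 'a) set \<Rightarrow> ('h \<Rightarrow> 'a) set \<Rightarrow> ('g \<times> 'h \<Rightarrow> 'a) set" where
  "mixed I' I J = {f \<in> tga_carrier (G \<times> H). (\<forall>y. slice f y \<in> I) \<and>
     (\<forall>L. linear_form L \<longrightarrow> (\<forall>h\<in>I'. L h = 0) \<longrightarrow> (\<lambda>y. L (slice f y)) \<in> J)}"

text \<open>The right ideal \<open>I \<otimes> (F * H)\<close>.\<close>

definition extend :: "('g \<Rightarrow> 'a) set \<Rightarrow> ('g \<times> 'h \<Rightarrow> 'a) set" where
  "extend I = {f \<in> tga_carrier (G \<times> H). \<forall>y. slice f y \<in> I}"

lemma mixed_right_ideal: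
  assumes I': "I' \<in> R1" and I: "I \<in> R1" and J: "J \<in> R2"
  shows "mixed I' I J \<in> T"
proof (rule right_idealI[OF GH])
  note DI' = right_idealD[OF G I'] and DI = right_idealD[OF G I] and DJ = right_idealD[OF H J]
  show "mixed I' I J \<subseteq> tga_carrier (G \<times> H)" by (auto simp: mixed_def)
  have "(\<lambda>_. 0) \<in> J" using DJ(2) by (simp add: zero_fun_def)
  then show "0 \<in> mixed I' I J"
    using DI(2) by (simp add: mixed_def tga_carrier_zero slice_zero linear_form_zero)
  fix f assume f: "f \<in> mixed I' I J"
  have fJ: "(\<lambda>y. L (slice f y)) \<in> J" if "linear_form L" "\<And>h. h \<in> I' \<Longrightarrow> L h = 0" for L
    using f that by (simp add: mixed_def)
  have fI: "slice f y \<in> I" for y using f by (simp add: mixed_def)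
  have fc: "f \<in> tga_carrier (G \<times> H)" using f by (simp add: mixed_def)
  show "f + g \<in> mixed I' I J" if g: "g \<in> mixed I' I J" for g
  proof -
    have "(\<lambda>y. L (slice (f + g) y)) \<in> J" if L: "linear_form L" "\<forall>h\<in>I'. L h = 0" for L
    proof -
      have "(\<lambda>y. L (slice g y)) \<in> J" using g L by (simp add: mixed_def)
      moreover have "(\<lambda>y. L (slice (f + g) y)) = (\<lambda>y. L (slice f y)) + (\<lambda>y. L (slice g y))"
        by (auto simp: slice_add linear_form_add[OF L(1)])
      ultimately show ?thesis using DJ(3) fJ L by metis
    qed
    then show ?thesis using g fc fI DI(3) by (simp add: mixed_def slice_add tga_carrier_add)
  qed
  show "smul c f \<in> mixed I' I J" for c
  proof -
    have "(\<lambda>y. L (slice (smul c f) y)) \<in> J" if L: "linear_form L" "\<forall>h\<in>I'. L h = 0" for L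
    proof -
      have "(\<lambda>y. L (slice (smul c f) y)) = smul c (\<lambda>y. L (slice f y))"
        by (simp add: slice_smul linear_form_smul[OF L(1)]) (simp add: smul_def)
      then show ?thesis using DJ(4) fJ L by metis
    qed
    then show ?thesis using fc fI DI(4) by (simp add: mixed_def slice_smul tga_carrier_smul)
  qed
  show "translate (tensor_cocycle \<tau>1 \<tau>2) b f \<in> mixed I' I J" (is "?t \<in> _") if b: "b \<in> G \<times> H" for b
  proof -
    have b': "fst b \<in> G" "snd b \<in> H" using b by auto
    have "(\<lambda>y. L (slice ?t y)) \<in> J" if L: "linear_form L" "\<forall>h\<in>I'. L h = 0" for L
    proof -
      \<comment> \<open>Since \<open>I'\<close> is a right ideal, \<open>L'\<close> again vanishes
        on \<open>I'\<close>, so \<open>f\<close> may be tested against it; what remains is a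
        translation by \<open>snd b\<close>, under which \<open>J\<close> is stable.\<close>
      define L' where "L' h = L (translate \<tau>1 (fst b) h)" for h
      have "translate \<tau>1 (fst b) (h + k) = translate \<tau>1 (fst b) h + translate \<tau>1 (fst b) k"
        "translate \<tau>1 (fst b) (smul c h) = smul c (translate \<tau>1 (fst b) h)" for h k c
        by (auto simp: translate_def smul_def algebra_simps)
      then have "linear_form L'" using L(1) by (simp add: linear_form_def L'_def)
      moreover have "L' h = 0" if "h \<in> I'" for h
        using DI'(5)[OF that b'(1)] L(2) by (simp add: L'_def)
      ultimately have "(\<lambda>y. L' (slice f y)) \<in> J" by (rule fJ)
      then have "translate \<tau>2 (snd b) (\<lambda>y. L' (slice f y)) \<in> J" using b'(2) by (rule DJ(5))
      moreover have "(\<lambda>y. L (slice ?t y)) = translate \<tau>2 (snd b) (\<lambda>y. L' (slice f y))"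
        by (simp add: slice_translate linear_form_smul[OF L(1)] L'_def)
          (simp add: translate_def[of \<tau>2] mult.commute)
      ultimately show ?thesis by simp
    qed
    moreover have "slice ?t y \<in> I" for y
      unfolding slice_translate by (intro DI(4) DI(5) fI b'(1))
    ultimately show ?thesis using tga_carrier_translate[OF GH(1) b fc] by (simp add: mixed_def)
  qed
qed

text \<open>The case \<open>I' = I\<close> with \<open>J\<close> the whole algebra of
  \<open>H\<close>: the condition on linear forms then only asks for finite support in
  \<open>H\<close>, which is automatic.\<close>

lemma extend_right_ideal:
  assumes "I \<in> R1"
  shows "extend I \<in> T"
proof -
  have "(\<lambda>y. L (slice f y)) \<in> tga_carrier H"
    if f: "f \<in> tga_carrier (G \<times> H)" and L: "linear_form L" for f and L :: "('g \<Rightarrow> 'a) \<Rightarrow> 'a"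
  proof -
    have "y \<in> snd ` {x. f x \<noteq> 0}" if "L (slice f y) \<noteq> 0" for y
    proof -
      have "slice f y \<noteq> 0" using that linear_form_zero[OF L] by auto
      then obtain x where "f (x, y) \<noteq> 0" by (auto simp: slice_def fun_eq_iff)
      then show ?thesis by force
    qed
    then have "{y. L (slice f y) \<noteq> 0} \<subseteq> snd ` {x. f x \<noteq> 0}" by blast
    moreover have "finite (snd ` {x. f x \<noteq> 0})" "snd ` {x. f x \<noteq> 0} \<subseteq> H"
      using f by (auto simp: tga_carrier_def)
    ultimately show ?thesis unfolding tga_carrier_def by (blast intro: finite_subset)
  qed
  then have "extend I = mixed I I (tga_carrier H)" by (auto simp: extend_def mixed_def)
  then show ?thesis using mixed_right_ideal[OF assms assms carrier_right_ideal[OF H]] by simp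
qed

text \<open>\<open>J\<close> is recovered from \<open>mixed I' I J\<close>: choose \<open>h\<close>
  in \<open>I\<close> outside \<open>I'\<close> and a form \<open>L\<close> that vanishes on
  \<open>I'\<close> with \<open>L h = 1\<close>; applying \<open>L\<close> to the slices of
  \<open>h \<otimes> j\<close> returns \<open>j\<close>. So the interval contains a copy of
  \<open>R2\<close>.\<close>

lemma deviation_le_between_extends:
  assumes I': "I' \<in> R1" and I: "I \<in> R1" and lt: "I' \<subset> I"
    and dev: "deviation_le k {x \<in> T. extend I' \<le> x \<and> x \<le> extend I}"
  shows "deviation_le k R2"
proof (rule deviation_le_map[OF dev, of _ "mixed I' I"])
  fix J assume J: "J \<in> R2"
  have "(\<lambda>_. 0) \<in> J" using right_idealD(2)[OF H J] by (simp add: zero_fun_def)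
  then have "extend I' \<subseteq> mixed I' I J" using lt by (auto simp: extend_def mixed_def)
  moreover have "mixed I' I J \<subseteq> extend I" by (auto simp: extend_def mixed_def)
  ultimately show "mixed I' I J \<in> {x \<in> T. extend I' \<le> x \<and> x \<le> extend I}"
    using mixed_right_ideal[OF I' I J] by simp
next
  fix J J' :: "('h \<Rightarrow> 'a) set" assume "J \<le> J'"
  then show "mixed I' I J \<le> mixed I' I J'" by (auto simp: mixed_def)
next
  fix J J' assume J: "J \<in> R2" "J' \<in> R2" "J \<le> J'" "mixed I' I J = mixed I' I J'"
  obtain h where h: "h \<in> I" "h \<notin> I'" using lt by blast
  obtain L where L: "linear_form L" "\<And>f. f \<in> I' \<Longrightarrow> L f = 0" "L h = 1"
    by (rule separating_linear_form[of I' h]) (use right_idealD[OF G I'] h(2) in auto)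
  have "j \<in> J" if j: "j \<in> J'" for j
  proof -
    \<comment> \<open>The pure tensor \<open>h \<otimes> j\<close>.\<close>
    define f where "f = (\<lambda>(x, y). h x * j y)"
    have slice: "slice f y = smul (j y) h" for y by (auto simp: f_def slice_def smul_def)
    have hj: "h \<in> tga_carrier G" "j \<in> tga_carrier H"
      using right_idealD(1)[OF G I] right_idealD(1)[OF H J(2)] h(1) j by auto
    have "{x. f x \<noteq> 0} = {x. h x \<noteq> 0} \<times> {y. j y \<noteq> 0}" by (auto simp: f_def)
    then have "finite {x. f x \<noteq> 0}" using hj by (simp add: tga_carrier_def)
    then have "f \<in> tga_carrier (G \<times> H)" using hj by (auto simp: tga_carrier_def f_def)
    moreover have "(\<lambda>y. M (slice f y)) \<in> J'" if "linear_form M" for M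
    proof -
      have "(\<lambda>y. M (slice f y)) = smul (M h) j"
        unfolding slice linear_form_smul[OF that] by (simp add: smul_def mult.commute)
      then show ?thesis using right_idealD(4)[OF H J(2) j] by simp
    qed
    ultimately have "f \<in> mixed I' I J'"
      using right_idealD(4)[OF G I h(1)] by (simp add: mixed_def slice)
    then have "f \<in> mixed I' I J" using J(4) by simp
    then have "(\<lambda>y. L (slice f y)) \<in> J" using L(1,2) unfolding mixed_def by blast
    then show ?thesis by (simp add: slice linear_form_smul[OF L(1)] L(3))
  qed
  then show "J = J'" using J(3) by blast
qed

text \<open>Formulated for intervals so that the induction on \<open>a\<close> applies to the
  factors of a chain. A chain with infinitely many large factors is carried by \<open>extend\<close>
  to one whose corresponding factors are larger by \<open>b\<close>; for \<open>a = 0\<close> the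
  interval is nontrivial and contains a copy of \<open>R2\<close>.\<close>

lemma not_deviation_le_add_interval:
  assumes "I' \<in> R1" "I \<in> R1"
    and "\<not> deviation_le a {x \<in> R1. I' \<le> x \<and> x \<le> I}" and b: "\<not> deviation_le b R2"
  shows "\<not> deviation_le (a + b) {x \<in> T. extend I' \<le> x \<and> x \<le> extend I}"
  using assms(1-3)
proof (induction a arbitrary: I I')
  case 0
  then have "I' \<subset> I" by auto
  then show ?case using deviation_le_between_extends[OF 0(1,2)] b by auto
next
  case (Suc a)
  let ?P = "{x \<in> R1. I' \<le> x \<and> x \<le> I}" and ?Q = "{x \<in> T. extend I' \<le> x \<and> x \<le> extend I}"
  obtain c where c: "\<And>i. c i \<in> ?P" "\<And>i. c (Suc i) \<le> c i"
    and nev: "\<not> (\<forall>\<^sub>F i in sequentially. deviation_le a {x \<in> ?P. c (Suc i) \<le> x \<and> x \<le> c i})"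
    using Suc.prems(3) unfolding deviation_le.simps by blast
  have ext_mono: "extend X \<le> extend Y" if "X \<le> Y" for X Y using that by (auto simp: extend_def)
  have ext_c: "extend (c i) \<in> ?Q" "extend (c (Suc i)) \<le> extend (c i)" for i
    using c[of i] extend_right_ideal[of "c i"] ext_mono by auto
  show ?case
  proof
    assume "deviation_le (Suc a + b) ?Q"
    then have "\<forall>\<^sub>F i in sequentially.
        deviation_le (a + b) {x \<in> ?Q. extend (c (Suc i)) \<le> x \<and> x \<le> extend (c i)}"
      unfolding add_Suc deviation_le.simps using ext_c
      by (elim allE[of _ "\<lambda>i. extend (c i)"]) blast
    then have "\<forall>\<^sub>F i in sequentially. deviation_le a {x \<in> ?P. c (Suc i) \<le> x \<and> x \<le> c i}"
    proof eventually_elim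
      case (elim i)
      have "deviation_le (a + b) {x \<in> T. extend (c (Suc i)) \<le> x \<and> x \<le> extend (c i)}"
        by (rule deviation_le_subset[OF elim]) (use ext_c[of i] ext_c[of "Suc i"] in auto)
      then have "deviation_le a {x \<in> R1. c (Suc i) \<le> x \<and> x \<le> c i}"
        using Suc.IH[of "c (Suc i)" "c i"] c(1)[of i] c(1)[of "Suc i"] by blast
      then show ?case by (rule deviation_le_subset) auto
    qed
    then show False using nev by contradiction
  qed
qed

text \<open>Because of the index shift, \<open>\<not> deviation_le a R1\<close> means dimension at
  least \<open>a\<close>, so the lower bounds add without correction. The interval from
  \<open>{0}\<close> to the whole algebra is all of \<open>R1\<close>.\<close>

theorem not_deviation_le_add:
  assumes "\<not> deviation_le a R1" "\<not> deviation_le b R2"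
  shows "\<not> deviation_le (a + b) T"
proof -
  have "{x \<in> R1. {0} \<le> x \<and> x \<le> tga_carrier G} = R1"
    using right_idealD(1,2)[OF G] by blast
  then have "\<not> deviation_le (a + b) {x \<in> T. extend {0} \<le> x \<and> x \<le> extend (tga_carrier G)}"
    using not_deviation_le_add_interval[OF zero_right_ideal[OF G] carrier_right_ideal[OF G]] assms
    by simp
  then show ?thesis by (rule contrapos_nn) (erule deviation_le_subset, blast)
qed

end

section \<open>Free abelian groups\<close>

lemma zadd_eq_plus: "zadd = (+)"
  by (auto simp: zadd_def fun_eq_iff)

lemma pair_add_plus: "pair_add (+) (+) = (+)"
  by (auto simp: pair_add_def fun_eq_iff plus_prod_def)

lemma add_subgroup_Zn: "add_subgroup (Zn n)"
  by (simp add: add_subgroup_def Zn_def)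

lemma Zn_0: "Zn 0 = {0}"
  by (auto simp: Zn_def fun_eq_iff)

lemma Zn_Suc_kernel: "{v \<in> Zn (Suc n). v n = 0} = Zn n"
  by (auto simp: Zn_def Suc_le_eq nat_less_le)

lemma Zn_subset_Suc: "Zn n \<subseteq> Zn (Suc n)"
  by (auto simp: Zn_def)

lemma Zn_Suc_coordinate: "\<exists>v\<in>Zn (Suc n). v n = m"
  by (rule bexI[of _ "\<lambda>i. if i = n then m else 0"]) (auto simp: Zn_def)

section \<open>Upper bounds by the rank\<close>

lemma finite_right_ideals_trivial_group:
  assumes "cocycle {0} (+) (\<tau> :: 'g::ab_group_add \<Rightarrow> 'g \<Rightarrow> 'a::field)"
  shows "finite (right_ideals {0} (+) \<tau>)"
proof -
  have G: "add_subgroup {0::'g}" by (simp add: add_subgroup_def)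
  have "I = {0} \<or> I = tga_carrier {0}" if I: "I \<in> right_ideals {0} (+) \<tau>" for I
  proof (cases "I = {0}")
    case False
    note D = right_idealD[OF G assms I]
    obtain f where f: "f \<in> I" "f \<noteq> 0" using False D(2) by blast
    have supp: "g x = 0" if "g \<in> tga_carrier {0::'g}" "x \<noteq> 0" for g :: "'g \<Rightarrow> 'a" and x
      using that by (auto simp: tga_carrier_def)
    have fc: "f \<in> tga_carrier {0}" using f D(1) by blast
    then have f0: "f 0 \<noteq> 0" using f(2) supp by (metis ext zero_fun_apply)
    have "g \<in> I" if g: "g \<in> tga_carrier {0}" for g
    proof -
      have "g = smul (g 0 / f 0) f"
      proof
        fix x show "g x = smul (g 0 / f 0) f x"
          using f0 supp[OF fc, of x] supp[OF g, of x] by (cases "x = 0") (auto simp: smul_def)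
      qed
      then show ?thesis using D(4)[OF f(1)] by metis
    qed
    then show ?thesis using D(1) by blast
  qed simp
  then have "right_ideals {0} (+) \<tau> \<subseteq> {{0}, tga_carrier {0}}" by blast
  then show ?thesis by (rule finite_subset) simp
qed

text \<open>The last coordinate is a degree map on \<open>Zn (Suc n)\<close> with kernel
  \<open>Zn n\<close>, so each coordinate costs at most one. With the index shift, the bound
  \<open>Suc n\<close> says that the dimension is at most \<open>n\<close>.\<close>

lemma right_ideals_Zn_bound:
  assumes "cocycle (Zn n) (+) (\<tau> :: _ \<Rightarrow> _ \<Rightarrow> 'a::field)"
  shows "acc (right_ideals (Zn n) (+) \<tau>) \<and> deviation_le (Suc n) (right_ideals (Zn n) (+) \<tau>)"
  using assms
proof (induction n)
  case 0
  then show ?case unfolding Zn_0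
    using finite_right_ideals_trivial_group acc_finite deviation_le_1_finite by blast
next
  case (Suc n)
  interpret graded_twisted_group_algebra "Zn (Suc n)" \<tau> "\<lambda>v. v n"
    by unfold_locales (simp_all add: add_subgroup_Zn Suc.prems Zn_Suc_coordinate)
  have H: "H = Zn n" unfolding H_def by (rule Zn_Suc_kernel)
  show ?case using Suc.IH H_cocycle deviation_le_extension unfolding H by blast
qed

text \<open>The coordinates of the second factor are adjoined one at a time, starting from the
  algebra of \<open>G\<close> itself.\<close>

lemma right_ideals_Times_Zn_bound:
  fixes \<tau>1 :: "'g::ab_group_add \<Rightarrow> 'g \<Rightarrow> 'a::field"
  assumes G: "add_subgroup G" "cocycle G (+) \<tau>1" and \<tau>2: "cocycle (Zn n) (+) \<tau>2"
    and acc: "acc (right_ideals G (+) \<tau>1)" and dev: "deviation_le k (right_ideals G (+) \<tau>1)"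
  shows "acc (right_ideals (G \<times> Zn n) (+) (tensor_cocycle \<tau>1 \<tau>2)) \<and>
    deviation_le (k + n) (right_ideals (G \<times> Zn n) (+) (tensor_cocycle \<tau>1 \<tau>2))"
  using \<tau>2
proof (induction n)
  case 0
  \<comment> \<open>\<open>G \<times> Zn 0\<close> is a copy of \<open>G\<close> whose cocycle is
    \<open>\<tau>1\<close> rescaled by the constant \<open>\<tau>2 0 0\<close>.\<close>
  note pull = right_ideals_pullback[OF add_subgroup_Times[OF G(1) add_subgroup_Zn]
      cocycle_tensor[OF G(2) 0] G, of "\<lambda>g. (g, 0)" "\<tau>2 0 0"]
  have nz: "\<tau>2 0 0 \<noteq> 0" using 0 by (simp add: cocycle_def Zn_0)
  have "inj (\<lambda>g::'g. (g, 0 :: nat \<Rightarrow> int))" by (simp add: inj_def)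
  then show ?case using acc dev nz
    by (intro conjI pull) (auto simp: Zn_0 tensor_cocycle_def)
next
  case (Suc n)
  interpret graded_twisted_group_algebra "G \<times> Zn (Suc n)" "tensor_cocycle \<tau>1 \<tau>2" "\<lambda>x. snd x n"
  proof
    show "\<exists>b\<in>G \<times> Zn (Suc n). snd b n = m" for m
      using Zn_Suc_coordinate[of n m] add_subgroup_0[OF G(1)] by force
    show "add_subgroup (G \<times> Zn (Suc n))"
      by (rule add_subgroup_Times[OF G(1) add_subgroup_Zn])
    show "cocycle (G \<times> Zn (Suc n)) (+) (tensor_cocycle \<tau>1 \<tau>2)"
      by (rule cocycle_tensor[OF G(2) Suc.prems])
    show "snd (x - y) n = snd x n - snd y n" for x y :: "'g \<times> (nat \<Rightarrow> int)" by simp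
  qed
  have H: "H = G \<times> Zn n" unfolding H_def Zn_Suc_kernel[of n, symmetric] by auto
  have "cocycle (Zn n) (+) \<tau>2" using Suc.prems Zn_subset_Suc[of n] unfolding cocycle_def by blast
  then show ?case using Suc.IH deviation_le_extension unfolding H add_Suc_right by blast
qed

text \<open>The upper bound adjoins coordinates to the first factor only; this symmetry makes it
  available for the other one.\<close>

lemma tensor_deviation_le_swap:
  assumes "add_subgroup G" "cocycle G (+) \<tau>1" "add_subgroup H" "cocycle H (+) \<tau>2"
    and "deviation_le k (right_ideals (H \<times> G) (+) (tensor_cocycle \<tau>2 \<tau>1))"
  shows "deviation_le k (right_ideals (G \<times> H) (+) (tensor_cocycle \<tau>1 \<tau>2))"
  using assms(5)
  by (rule right_ideals_pullback(2)[where \<psi> = prod.swap and c = 1, rotated -1])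
    (use assms(1-4) in \<open>auto simp: tensor_cocycle_def mult.commute
      intro: add_subgroup_Times cocycle_tensor\<close>)

theorem corollary5p10:
  fixes \<tau>1 \<tau>2 :: "(nat \<Rightarrow> int) \<Rightarrow> (nat \<Rightarrow> int) \<Rightarrow> 'a::field"
    and n1 n2 :: nat
  assumes "cocycle (Zn n1) zadd \<tau>1"
    and "cocycle (Zn n2) zadd \<tau>2"
    and "tga_dim (Zn n1) zadd \<tau>1 = enat n1 \<or> tga_dim (Zn n2) zadd \<tau>2 = enat n2"
  shows "tensor_tga_dim (Zn n1) zadd \<tau>1 (Zn n2) zadd \<tau>2
           = tga_dim (Zn n1) zadd \<tau>1 + tga_dim (Zn n2) zadd \<tau>2"
proof -
  have co: "cocycle (Zn n1) (+) \<tau>1" "cocycle (Zn n2) (+) \<tau>2"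
    using assms(1,2) by (simp_all add: zadd_eq_plus)
  interpret tensor_twisted_group_algebras "Zn n1" "Zn n2" \<tau>1 \<tau>2
    using co by unfold_locales (simp_all add: add_subgroup_Zn)
  \<comment> \<open>Stated over any group type, as it serves both for the factors and for the group
    of pairs.\<close>
  have dim_iff: "tga_dim K (+) \<tau> = enat d \<longleftrightarrow>
      deviation_le (Suc d) (right_ideals K (+) \<tau>) \<and> \<not> deviation_le d (right_ideals K (+) \<tau>)"
    if "add_subgroup K" "cocycle K (+) \<tau>" for K :: "'g::ab_group_add set" and \<tau> :: "_ \<Rightarrow> _ \<Rightarrow> 'a" and d
    using krull_dim_poset_eq_enat_iff[of "right_ideals K (+) \<tau>" d]
      right_ideals_not_deviation_le_0[OF that]
    unfolding tga_dim_def dev_le_eq_deviation_le by blast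
  have finite_dim: "\<exists>d. tga_dim (Zn n) (+) \<tau> = enat d"
    if "cocycle (Zn n) (+) \<tau>" for n and \<tau> :: "_ \<Rightarrow> _ \<Rightarrow> 'a"
    using right_ideals_Zn_bound[OF that]
    unfolding tga_dim_def krull_dim_poset_def dev_le_eq_deviation_le by metis
  obtain d1 d2 where d: "tga_dim (Zn n1) (+) \<tau>1 = enat d1" "tga_dim (Zn n2) (+) \<tau>2 = enat d2"
    using finite_dim co by blast
  then have dev: "deviation_le (Suc d1) R1" "\<not> deviation_le d1 R1"
    "deviation_le (Suc d2) R2" "\<not> deviation_le d2 R2"
    using dim_iff G H by blast+
  \<comment> \<open>The factor of full dimension is the one built up coordinate by coordinate over
    the other: its rank is then its dimension, and the upper bound becomes \<open>d1 + d2\<close>.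
    If it is the first factor, the two are swapped.\<close>
  have "deviation_le (Suc (d1 + d2)) T"
  proof (cases "d2 = n2")
    case True
    then show ?thesis
      using right_ideals_Times_Zn_bound[OF G co(2) _ dev(1)] right_ideals_Zn_bound[OF co(1)]
      unfolding add_Suc by blast
  next
    case False
    then have "d1 = n1" using assms(3) d by (simp add: zadd_eq_plus)
    then have "deviation_le (Suc d2 + d1)
        (right_ideals (Zn n2 \<times> Zn n1) (+) (tensor_cocycle \<tau>2 \<tau>1))"
      using right_ideals_Times_Zn_bound[OF H co(1) _ dev(3)] right_ideals_Zn_bound[OF co(2)] by blast
    then have "deviation_le (Suc d2 + d1) T" by (rule tensor_deviation_le_swap[OF G H])
    then show ?thesis by (simp only: add_Suc add.commute[of d1])
  qed
  moreover have "\<not> deviation_le (d1 + d2) T" using dev by (intro not_deviation_le_add)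
  ultimately have "tga_dim (Zn n1 \<times> Zn n2) (+) (tensor_cocycle \<tau>1 \<tau>2) = enat (d1 + d2)"
    using dim_iff[OF GH] by blast
  then show ?thesis
    by (simp add: tensor_tga_dim_def zadd_eq_plus pair_add_plus d)
qed

end
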